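(* Let $p$ be a prime, $d\ge 2$, $k\ge 2$, and $k\le n\le d(k-1)$ with $n\le p^d-1$. Let $\alpha$ be the generator of $\mathbb{F}_{p^d}^*$ fixed in the context, and let $\Phi(x)=\alpha x/(x+1)$. There exists a set $\mathrm{Bad}\subset\mathbb{F}_{p^d}^*$ with $$|\mathrm{Bad}|\le n+n(dp)^n$$ such that for every $x_0\in\mathbb{F}_{p^d}^*\setminus\mathrm{Bad}$, the places $x_j=\Phi^j(x_0)$, $0\le j\le n-1$, are pairwise distinct elements of $\mathbb{F}_{p^d}^*$, and the scheme $\mathrm{ShamirSS}(n,k,\vec X)_{\mathbb{F}_{p^d}}$ with $\vec X=(x_0,\dots,x_{n-1})$ is perfectly secure against all single-$\mathbb{F}_p$-block leakage patterns. In particular, for such $x_0$ the scheme is perfectly secure against all leakage of a single physical bit per share, and, for arbitrary nonempty finite sets $S_0,\dots,S_{n-1}$, against any leakage that applies an arbitrary function $g_j:\mathbb{F}_p\to S_j$ to a single $\mathbb{F}_p$-block of the share $s_j$, for each $j$ (the block may be different for each share). Moreover, $\mathbb{F}_{p^d}^*\setminus\mathrm{Bad}\neq\emptyset$ whenever $d>n(1+\log_p d)+\log_p(2n)$; and there is an absolute constant $c>0$ such that this inequality holds whenever $n\le c\,d/\log_p(pd)$.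
   Context: Let $\mathbb{F}=\mathbb{F}_{p^d}$, $\mathbb{F}^*=\mathbb{F}\setminus\{0\}$. Fix a primitive polynomial $\Pi\in\mathbb{F}_p[t]$ of degree $d$ and a root $\alpha\in\mathbb{F}$; so $\alpha$ generates $\mathbb{F}^*$ and $1,\alpha,\dots,\alpha^{d-1}$ is an $\mathbb{F}_p$-basis of $\mathbb{F}$. For $x=\sum_{i=0}^{d-1}x_i\alpha^i$ with $x_i\in\mathbb{F}_p$, write $(x)_i:=x_i$; these coordinates are the "$\mathbb{F}_p$-blocks" of $x$. $\Phi(x)=\alpha x/(x+1)$ is regarded as a Möbius transformation of $\mathbb{P}^1(\mathbb{F})=\mathbb{F}\cup\{\infty\}$, and $\Phi^j$ is its $j$-th iterate. Shamir's scheme: for $2\le k\le n$ and distinct places $x_0,\dots,x_{n-1}\in\mathbb{F}^*$, $\mathrm{ShamirSS}(n,k,\vec X)_{\mathbb{F}}$ shares a secret $s\in\mathbb{F}$ by sampling $a_1,\dots,a_{k-1}\in\mathbb{F}$ uniformly and independently, setting $P(x)=s+a_1x+\dots+a_{k-1}x^{k-1}$, and outputting the shares $s_j=P(x_j)$, $0\le j\le n-1$; write $\mathrm{Share}(s)=(s_0,\dots,s_{n-1})$. A single-block leakage pattern is a tuple $\vec i=(i_0,\dots,i_{n-1})\in\{0,\dots,d-1\}^n$; the leakage is $((s_j)_{i_j})_{j=0}^{n-1}\in\mathbb{F}_p^n$. The scheme is perfectly secure against a family $\mathcal{F}$ of leakage functions if for every $f\in\mathcal{F}$ and every $s\in\mathbb{F}^*$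 the distributions of $f(\mathrm{Share}(0))$ and $f(\mathrm{Share}(s))$ are identical (statistical distance $0$). Physical bits: each element of $\mathbb{F}$ is stored as its $d$ coordinates over $\mathbb{F}_p$, each coordinate written as a $\lceil\log_2 p\rceil$-bit binary string. Leakage of a single physical bit per share reveals, for each $j$, one chosen bit of the string of one chosen coordinate of $s_j$. *)

theory Defs
  imports
    "HOL-Probability.Probability"
    "Berlekamp_Zassenhaus.Finite_Field"
begin

text \<open>
  The prime field is the type \<open>'p mod_ring\<close> with \<open>'p\<close> of class \<open>prime_card\<close>, and the field with
  \<open>p ^ d\<close> elements is a finite field type \<open>'a\<close>.
\<close>

text \<open>
  The embedding of the prime field; it is a ring homomorphism when \<open>'a\<close> has characteristic
  \<open>CARD('p)\<close>.
\<close>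
definition emb :: "'p::prime_card mod_ring \<Rightarrow> 'a::field" where
  "emb c = of_int (to_int_mod_ring c)"

definition mult_generator :: "'a::field \<Rightarrow> bool" where
  "mult_generator \<beta> \<longleftrightarrow> \<beta> \<noteq> 0 \<and> (\<forall>x. x \<noteq> 0 \<longrightarrow> (\<exists>e::nat. x = \<beta> ^ e))"

definition is_min_poly :: "'p::prime_card mod_ring poly \<Rightarrow> 'a::field \<Rightarrow> bool" where
  "is_min_poly f \<beta> \<longleftrightarrow>
     lead_coeff f = 1 \<and> poly (map_poly emb f) \<beta> = 0 \<and>
     (\<forall>g :: 'p mod_ring poly. g \<noteq> 0 \<and> poly (map_poly emb g) \<beta> = 0 \<longrightarrow>
       degree f \<le> degree g)"

text \<open>
  A primitive polynomial is the minimal polynomial over the prime field of a generator of the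
  multiplicative group of the extension field, here the type \<open>'a\<close>.
\<close>
definition primitive_poly :: "'a::field itself \<Rightarrow> 'p::prime_card mod_ring poly \<Rightarrow> bool" where
  "primitive_poly _ f \<longleftrightarrow> (\<exists>\<beta>::'a. mult_generator \<beta> \<and> is_min_poly f \<beta>)"

text \<open>
  The degree \<open>d\<close> and the prime field are read off from \<open>\<pi>\<close>. The description is meaningful when
  the powers \<open>1, \<dots>, \<alpha> ^ (d - 1)\<close> form a basis over the prime field.
\<close>
definition coords :: "'p::prime_card mod_ring poly \<Rightarrow> 'a::field \<Rightarrow> 'a \<Rightarrow> 'p mod_ring list" where
  "coords \<pi> \<alpha> x =
     (THE c. length c = degree \<pi> \<and> x = (\<Sum>i<degree \<pi>. emb (c ! i) * \<alpha> ^ i))"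

definition block :: "'p::prime_card mod_ring poly \<Rightarrow> 'a::field \<Rightarrow> nat \<Rightarrow> 'a \<Rightarrow> 'p mod_ring" where
  "block \<pi> \<alpha> i x = coords \<pi> \<alpha> x ! i"

text \<open>Binary string of the representative in \<open>{0..<p}\<close>, least significant bit first.\<close>
definition bit_string :: "'p::prime_card mod_ring \<Rightarrow> bool list" where
  "bit_string c = map (bit (to_int_mod_ring c)) [0..<nat \<lceil>log 2 (real CARD('p))\<rceil>]"

datatype 'a proj_line = Fin 'a | Infinity

fun Phi :: "'a::field \<Rightarrow> 'a proj_line \<Rightarrow> 'a proj_line" where
  "Phi \<alpha> (Fin x) = (if x + 1 = 0 then Infinity else Fin (\<alpha> * x / (x + 1)))"
| "Phi \<alpha> Infinity = Fin \<alpha>"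

definition Share :: "nat \<Rightarrow> 'a::{field,finite} list \<Rightarrow> 'a \<Rightarrow> 'a list pmf" where
  "Share k X s =
     map_pmf (\<lambda>a. map (poly (Poly (s # a))) X) (replicate_pmf (k - 1) (pmf_of_set UNIV))"

definition perfectly_secure ::
    "nat \<Rightarrow> 'a::{field,finite} list \<Rightarrow> ('a list \<Rightarrow> 'b) set \<Rightarrow> bool" where
  "perfectly_secure k X \<F> \<longleftrightarrow>
     (\<forall>f\<in>\<F>. \<forall>s. s \<noteq> 0 \<longrightarrow> map_pmf f (Share k X 0) = map_pmf f (Share k X s))"

definition block_leakages ::
    "'p::prime_card mod_ring poly \<Rightarrow> 'a::field \<Rightarrow> nat \<Rightarrow> ('a list \<Rightarrow> 'p mod_ring list) set" where
  "block_leakages \<pi> \<alpha> n =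
     {(\<lambda>s. map (\<lambda>j. block \<pi> \<alpha> (i j) (s ! j)) [0..<n]) | i. \<forall>j<n. i j < degree \<pi>}"

definition bit_leakages ::
    "'p::prime_card mod_ring poly \<Rightarrow> 'a::field \<Rightarrow> nat \<Rightarrow> ('a list \<Rightarrow> bool list) set" where
  "bit_leakages \<pi> \<alpha> n =
     {(\<lambda>s. map (\<lambda>j. bit_string (block \<pi> \<alpha> (i j) (s ! j)) ! b j) [0..<n]) | i b.
        \<forall>j<n. i j < degree \<pi> \<and> b j < nat \<lceil>log 2 (real CARD('p))\<rceil>}"

definition block_fun_leakages ::
    "'p::prime_card mod_ring poly \<Rightarrow> 'a::field \<Rightarrow> nat \<Rightarrow> (nat \<Rightarrow> 's set) \<Rightarrow>
      ('a list \<Rightarrow> 's list) set" where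
  "block_fun_leakages \<pi> \<alpha> n S =
     {(\<lambda>s. map (\<lambda>j. g j (block \<pi> \<alpha> (i j) (s ! j))) [0..<n]) | i g.
        \<forall>j<n. i j < degree \<pi> \<and> range (g j) \<subseteq> S j}"

definition admissible :: "nat \<Rightarrow> nat \<Rightarrow> nat \<Rightarrow> nat \<Rightarrow> bool" where
  "admissible p d k n \<longleftrightarrow>
     prime p \<and> 2 \<le> d \<and> 2 \<le> k \<and> k \<le> n \<and> n \<le> d * (k - 1) \<and> n \<le> p ^ d - 1"

definition good_params :: "nat \<Rightarrow> nat \<Rightarrow> nat \<Rightarrow> bool" where
  "good_params p d n \<longleftrightarrow>
     real d > real n * (1 + log (real p) (real d)) + log (real p) (2 * real n)"

end

theory Submission
  imports Defs
begin

text \<open>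
  Leaking one block per share is a linear map over the prime field. Every such functional is
  \<open>z \<mapsto> \<lambda> (\<mu> * z)\<close> for one fixed functional \<open>\<lambda>\<close>, so the pattern \<open>i\<close> leaks the values
  \<open>\<lambda> (\<mu>\<^bsub>i j\<^esub> * P (x\<^sub>j))\<close>. If the elements \<open>\<mu>\<^bsub>i j\<^esub> * x\<^sub>j\<close> are linearly independent over the prime
  field, some \<open>a\<close> satisfies \<open>\<lambda> (\<mu>\<^bsub>i j\<^esub> * a * x\<^sub>j) = \<lambda> (\<mu>\<^bsub>i j\<^esub> * s)\<close> for all \<open>j\<close>, and shifting the
  linear coefficient of \<open>P\<close> by \<open>a\<close> turns sharings of \<open>s\<close> into sharings of \<open>0\<close> with the same leakage.

  With \<open>y = 1 / x\<^sub>0\<close> and \<open>c\<^sub>j = 1 + \<alpha> + \<dots> + \<alpha> ^ (j - 1)\<close> one has \<open>x\<^sub>j = \<alpha> ^ j / (y + c\<^sub>j)\<close>. The \<open>c\<^sub>j\<close> are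
  distinct, so each nontrivial relation \<open>(\<Sum>j<n. e\<^sub>j * x\<^sub>j) = 0\<close> has fewer than \<open>n\<close> solutions \<open>y\<close>, and only
  \<open>(d * p) ^ n\<close> coefficient tuples \<open>e\<^sub>j = emb (f j) * \<mu>\<^bsub>i j\<^esub>\<close> occur. The poles \<open>- c\<^sub>j\<close> with \<open>0 < j\<close> and
  the fixed point \<open>y = 1 / (\<alpha> - 1)\<close> account for the remaining \<open>n\<close> bad places.
\<close>

section \<open>Preliminaries: partial fractions, the prime field, shifted sharings, orbits of
  \<open>Phi\<close>\<close>

text \<open>Clearing denominators yields a polynomial \<open>Q\<close> of degree at most
  \<open>card I - 1\<close>. It is nonzero because at \<open>- c i\<close> with
  \<open>e i \<noteq> 0\<close> all summands but the \<open>i\<close>-th vanish, and the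
  \<open>i\<close>-th does not since the \<open>c l\<close> are distinct.\<close>

lemma card_partial_fraction_zeros:
  fixes c e :: "'i \<Rightarrow> 'a::field"
  assumes fin: "finite I" and inj: "inj_on c I" and nz: "\<exists>i\<in>I. e i \<noteq> 0"
  defines "Z \<equiv> {y. (\<forall>i\<in>I. y + c i \<noteq> 0) \<and> (\<Sum>i\<in>I. e i / (y + c i)) = 0}"
  shows "finite Z" and "card Z \<le> card I - 1"
proof -
  define Q where "Q = (\<Sum>i\<in>I. Polynomial.smult (e i) (\<Prod>l\<in>I - {i}. [:c l, 1:]))"
  have poly_Q: "poly Q y = (\<Sum>i\<in>I. e i * (\<Prod>l\<in>I - {i}. y + c l))" for y
    by (simp add: Q_def poly_sum poly_prod add.commute)
  obtain i where i: "i \<in> I" "e i \<noteq> 0" using nz by blast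
  have "poly Q (- c i) = (\<Sum>j\<in>I. if j = i then e i * (\<Prod>l\<in>I - {i}. c l - c i) else 0)"
    unfolding poly_Q using fin i(1) by (intro sum.cong) (auto intro!: prod_zero)
  also have "\<dots> = e i * (\<Prod>l\<in>I - {i}. c l - c i)"
    using fin i(1) by simp
  also have "\<dots> \<noteq> 0"
    using fin i inj by (auto simp: inj_on_def)
  finally have Q0: "Q \<noteq> 0" by auto
  have "degree Q \<le> card I - 1"
    unfolding Q_def
  proof (rule degree_sum_le[OF fin])
    fix j assume j: "j \<in> I"
    have "degree (\<Prod>l\<in>I - {j}. [:c l, 1:]) \<le> (\<Sum>l\<in>I - {j}. degree [:c l, 1:])"
      using fin by (intro degree_prod_sum_le[unfolded comp_def]) auto
    also have "\<dots> = card I - 1" using fin j by simp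
    finally show "degree (Polynomial.smult (e j) (\<Prod>l\<in>I - {j}. [:c l, 1:])) \<le> card I - 1"
      using degree_smult_le order_trans by blast
  qed
  moreover have "Z \<subseteq> {y. poly Q y = 0}"
  proof
    fix y assume y: "y \<in> Z"
    have "poly Q y = (\<Sum>i\<in>I. (\<Prod>l\<in>I. y + c l) * (e i / (y + c i)))"
      unfolding poly_Q
    proof (rule sum.cong)
      fix i assume i: "i \<in> I"
      then have "y + c i \<noteq> 0" using y by (simp add: Z_def)
      then show "e i * (\<Prod>l\<in>I - {i}. y + c l) = (\<Prod>l\<in>I. y + c l) * (e i / (y + c i))"
        by (simp add: prod.remove[OF fin i])
    qed simp
    also have "\<dots> = 0"
      using y by (simp only: Z_def mem_Collect_eq sum_distrib_left[symmetric]) simp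
    finally show "y \<in> {y. poly Q y = 0}" by simp
  qed
  moreover note card_poly_roots_bound[OF Q0] poly_roots_finite[OF Q0]
  ultimately show "finite Z" "card Z \<le> card I - 1"
    by (auto intro: finite_subset card_mono order_trans)
qed

lemma of_int_mod_eq:
  assumes "of_nat m = (0 :: 'a::ring_1)"
  shows "of_int (x mod int m) = (of_int x :: 'a)"
  using assms by (simp add: minus_mult_div_eq_mod[symmetric])

text \<open>Representatives respect sums and products only up to reduction modulo
  \<open>CARD('p)\<close>, and \<open>of_int\<close> does not see that reduction once
  \<open>CARD('p)\<close> is zero in the target.\<close>

lemma field_hom_emb:
  assumes "of_nat CARD('p) = (0 :: 'a)"
  shows "field_hom (emb :: 'p::prime_card mod_ring \<Rightarrow> 'a::field)"
  by unfold_locales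
    (simp_all add: emb_def to_int_mod_ring_add to_int_mod_ring_mult of_int_mod_eq[OF assms])

text \<open>A coupling argument: since \<open>k \<ge> 2\<close> there is a linear coefficient, and
  its uniform distribution is invariant under translation by \<open>a\<close>. The shift
  \<open>a\<close> may depend on \<open>f\<close> and \<open>s\<close>, but not on the sampled
  coefficients.\<close>

lemma map_pmf_Share_shift:
  fixes X :: "'a::{field,finite} list"
  assumes k: "2 \<le> k"
    and shift: "\<And>b bs. f (map (poly (Poly (0 # (b + a) # bs))) X) =
                         f (map (poly (Poly (s # b # bs))) X)"
  shows "map_pmf f (Share k X 0) = map_pmf f (Share k X s)"
proof -
  let ?U = "pmf_of_set (UNIV :: 'a set)"
  have U: "?U = map_pmf (\<lambda>b. b + a) ?U"
    by (intro map_pmf_of_set_bij_betw[symmetric] bij_betw_byWitness[where f' = "\<lambda>b. b - a"]) auto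
  obtain m where m: "k - 1 = Suc m" using k by (cases "k - 1") auto
  have Share_eq: "map_pmf f (Share k X t) =
      bind_pmf ?U (\<lambda>b. bind_pmf (replicate_pmf m ?U) (\<lambda>bs.
        return_pmf (f (map (poly (Poly (t # b # bs))) X))))" for t
    by (simp add: Share_def m[simplified] map_pmf_def bind_assoc_pmf bind_return_pmf del: Poly.simps)
  show ?thesis
    unfolding Share_eq by (subst U) (simp add: bind_map_pmf shift del: Poly.simps)
qed

text \<open>In the coordinate \<open>1 / x\<close> the map is affine, \<open>y \<mapsto> (y + 1) / \<alpha>\<close>.\<close>
lemma Phi_funpow:
  fixes x :: "'a::field"
  assumes "x \<noteq> 0" and "\<And>i. i \<le> j \<Longrightarrow> inverse x + (\<Sum>l<i. \<alpha> ^ l) \<noteq> 0"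
  shows "(Phi \<alpha> ^^ j) (Fin x) = Fin (\<alpha> ^ j / (inverse x + (\<Sum>l<j. \<alpha> ^ l)))"
  using assms(2)
proof (induction j)
  case 0
  then show ?case using assms(1) by (simp add: field_simps)
next
  case (Suc j)
  define u where "u = inverse x + (\<Sum>l<j. \<alpha> ^ l)"
  have u: "u \<noteq> 0" "u + \<alpha> ^ j \<noteq> 0"
    using Suc.prems[of j] Suc.prems[of "Suc j"] by (simp_all add: u_def add.assoc)
  have "\<alpha> ^ j / u + 1 = (u + \<alpha> ^ j) / u" using u by (simp add: field_simps)
  then have "Phi \<alpha> (Fin (\<alpha> ^ j / u)) = Fin (\<alpha> ^ Suc j / (u + \<alpha> ^ j))"
    using u by simp
  then show ?case using Suc by (simp add: u_def add.assoc)
qed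

section \<open>Power basis and coordinates of the extension field\<close>

text \<open>Primitivity of \<open>\<pi>\<close> is witnessed by some generator \<beta>, while
  \<alpha> is only assumed to be a root; what is needed about \<alpha> is carried over from \<beta>
  through divisibility by \<open>\<pi>\<close>.\<close>

locale primitive_extension =
  fixes \<pi> :: "'p::prime_card mod_ring poly" and \<alpha> :: "'a::{field,finite}"
  assumes card_field: "CARD('a) = CARD('p) ^ degree \<pi>"
    and primitive: "primitive_poly TYPE('a) \<pi>"
    and root: "poly (map_poly emb \<pi>) \<alpha> = 0"
begin

lemma char_eq_0: "of_nat CARD('p) = (0::'a)"
proof -
  have "of_nat CARD('a) = (0::'a)"
    using CHAR_dvd_CARD[where 'a='a] by (simp add: of_nat_eq_0_iff_char_dvd)
  then show ?thesis by (simp add: card_field)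
qed

sublocale emb: field_hom "emb :: 'p mod_ring \<Rightarrow> 'a"
  by (rule field_hom_emb[OF char_eq_0])

sublocale emb_poly: map_poly_idom_hom "emb :: 'p mod_ring \<Rightarrow> 'a" ..

lemma poly_emb_sum_monom:
  "poly (map_poly emb (\<Sum>i<m. Polynomial.monom (c i :: 'p mod_ring) i)) x = (\<Sum>i<m. emb (c i) * (x::'a) ^ i)"
  by (simp add: emb_poly.hom_sum poly_sum poly_monom)

text \<open>Let \<open>f\<close> be a nonzero polynomial of least degree vanishing at \<alpha>.
  Division with remainder shows that \<open>f\<close> divides every such polynomial, so
  \<open>\<pi> = f * q\<close>. Now \<beta> is a root of \<open>f\<close> or of \<open>q\<close>,
  and minimality of \<open>\<pi>\<close> at \<beta> together with \<open>degree f \<noteq> 0\<close>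
  leaves only a constant \<open>q\<close>.\<close>

lemma dvd_of_root:
  fixes g :: "'p mod_ring poly"
  assumes g: "poly (map_poly emb g) \<alpha> = 0"
  shows "\<pi> dvd g"
proof -
  obtain \<beta> :: 'a where \<beta>: "is_min_poly \<pi> \<beta>"
    using primitive by (auto simp: primitive_poly_def)
  then have \<pi>0: "\<pi> \<noteq> 0" and \<pi>\<beta>: "poly (map_poly emb \<pi>) \<beta> = 0"
    and min: "\<And>h :: 'p mod_ring poly. h \<noteq> 0 \<Longrightarrow> poly (map_poly emb h) \<beta> = 0 \<Longrightarrow> degree \<pi> \<le> degree h"
    by (auto simp: is_min_poly_def)
  let ?R = "\<lambda>f :: 'p mod_ring poly. f \<noteq> 0 \<and> poly (map_poly emb f) \<alpha> = 0"
  obtain f where f: "?R f" and f_min: "\<And>h. ?R h \<Longrightarrow> degree f \<le> degree h"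
    using ex_has_least_nat[of ?R \<pi> degree] \<pi>0 root by blast
  have f_dvd: "f dvd h" if h: "poly (map_poly emb h) \<alpha> = 0" for h
  proof -
    have "poly (map_poly emb h) \<alpha> = poly (map_poly emb (f * (h div f) + h mod f)) \<alpha>"
      by simp
    also have "\<dots> = poly (map_poly emb (h mod f)) \<alpha>"
      using f by (simp only: emb_poly.hom_add emb_poly.hom_mult poly_add poly_mult) simp
    finally have "poly (map_poly emb (h mod f)) \<alpha> = 0" using h by simp
    then have "h mod f = 0"
      using f_min[of "h mod f"] f degree_mod_less'[of f h] by fastforce
    then show ?thesis by (simp add: mod_eq_0_iff_dvd)
  qed
  obtain q where q: "\<pi> = f * q" using f_dvd[OF root] by blast
  have q0: "q \<noteq> 0" using q \<pi>0 by auto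
  have deg: "degree \<pi> = degree f + degree q"
    using q f q0 by (simp add: degree_mult_eq)
  have "degree f \<noteq> 0"
  proof
    assume "degree f = 0"
    then obtain c where "f = [:c:]" by (rule degree_eq_zeroE)
    with f show False by (simp add: Polynomial.map_poly_pCons)
  qed
  moreover have "poly (map_poly emb f) \<beta> = 0 \<or> poly (map_poly emb q) \<beta> = 0"
    using \<pi>\<beta> by (simp add: q emb_poly.hom_mult)
  ultimately have "degree q = 0" using min[of f] min[of q] f q0 deg by auto
  then have "is_unit q" using q0 by (simp add: is_unit_iff_degree)
  then have "\<pi> dvd f" using q by (simp add: mult_unit_dvd_iff)
  then show ?thesis using f_dvd[OF g] by (rule dvd_trans)
qed

lemma degree_pos: "0 < degree \<pi>"
proof (rule ccontr)
  assume "\<not> 0 < degree \<pi>"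
  then have "card (UNIV :: 'a set) = 1" using card_field by simp
  then show False by (metis UNIV_I card_1_singletonE singletonD zero_neq_one)
qed

text \<open>Two coordinate lists of the same element differ by a polynomial of degree below
  \<open>degree \<pi>\<close> that \<open>\<pi>\<close> divides, hence by zero. Surjectivity follows
  by counting. This makes the description in \<open>coords\<close> meaningful.\<close>

lemma bij_betw_coords:
  "bij_betw (\<lambda>c. \<Sum>i<degree \<pi>. emb (c ! i) * \<alpha> ^ i) {c :: 'p mod_ring list. length c = degree \<pi>} UNIV"
proof -
  let ?L = "{c :: 'p mod_ring list. length c = degree \<pi>}"
  let ?f = "\<lambda>c. \<Sum>i<degree \<pi>. emb (c ! i) * \<alpha> ^ i"
  have inj: "inj_on ?f ?L"
  proof (rule inj_onI)
    fix c c' :: "'p mod_ring list"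
    assume len: "c \<in> ?L" "c' \<in> ?L" and eq: "?f c = ?f c'"
    define g where "g = (\<Sum>i<degree \<pi>. Polynomial.monom (c ! i - c' ! i) i)"
    have "poly (map_poly emb g) \<alpha> = ?f c - ?f c'"
      by (simp add: g_def poly_emb_sum_monom emb.hom_minus algebra_simps sum_subtractf)
    then have "\<pi> dvd g" using eq by (intro dvd_of_root) simp
    moreover have "degree g < degree \<pi>"
      unfolding g_def using degree_pos
      by (intro degree_sum_less) (auto intro: le_less_trans[OF degree_monom_le])
    ultimately have "g = 0" using dvd_imp_degree_le leD by blast
    have "c ! i = c' ! i" if "i < degree \<pi>" for i
    proof -
      have "Polynomial.coeff g i = c ! i - c' ! i" using that by (simp add: g_def coeff_sum coeff_monom)
      with \<open>g = 0\<close> show ?thesis by simp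
    qed
    with len show "c = c'" by (auto intro: nth_equalityI)
  qed
  have "card ?L = CARD('a)"
    using card_lists_length_eq[of "UNIV :: 'p mod_ring set" "degree \<pi>"] card_field by simp
  then have "?f ` ?L = UNIV"
    using inj by (intro card_subset_eq) (auto simp: card_image)
  with inj show ?thesis by (simp add: bij_betw_def)
qed

lemma coords_lincomb:
  assumes "length c = degree \<pi>"
  shows "coords \<pi> \<alpha> (\<Sum>i<degree \<pi>. emb (c ! i) * \<alpha> ^ i) = c"
  unfolding coords_def
proof (rule the_equality)
  fix c' :: "'p mod_ring list"
  assume "length c' = degree \<pi> \<and> (\<Sum>i<degree \<pi>. emb (c ! i) * \<alpha> ^ i) = (\<Sum>i<degree \<pi>. emb (c' ! i) * \<alpha> ^ i)"
  then show "c' = c"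
    using assms by (intro inj_onD[OF bij_betw_imp_inj_on[OF bij_betw_coords]]) simp_all
qed (simp add: assms)

lemma lincomb_block: "x = (\<Sum>i<degree \<pi>. emb (block \<pi> \<alpha> i x) * \<alpha> ^ i)"
proof -
  have "x \<in> (\<lambda>c. \<Sum>i<degree \<pi>. emb (c ! i) * \<alpha> ^ i) ` {c :: 'p mod_ring list. length c = degree \<pi>}"
    using bij_betw_coords by (simp add: bij_betw_def)
  then obtain c :: "'p mod_ring list"
    where c: "length c = degree \<pi>" "x = (\<Sum>i<degree \<pi>. emb (c ! i) * \<alpha> ^ i)" by blast
  then have "coords \<pi> \<alpha> x = c" using coords_lincomb by blast
  then show ?thesis unfolding block_def using c(2) by (simp only:)
qed

lemma block_lincomb:
  assumes "i < degree \<pi>"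
  shows "block \<pi> \<alpha> i (\<Sum>j<degree \<pi>. emb (c j) * \<alpha> ^ j) = c i"
  using coords_lincomb[of "map c [0..<degree \<pi>]"] assms by (simp add: block_def)

lemma block_add:
  assumes "i < degree \<pi>"
  shows "block \<pi> \<alpha> i (x + y) = block \<pi> \<alpha> i x + block \<pi> \<alpha> i y"
proof -
  have "x + y = (\<Sum>j<degree \<pi>. emb (block \<pi> \<alpha> j x + block \<pi> \<alpha> j y) * \<alpha> ^ j)"
    by (simp only: emb.hom_add distrib_right sum.distrib lincomb_block[symmetric])
  then show ?thesis using block_lincomb[OF assms] by simp
qed

lemma block_scale:
  assumes "i < degree \<pi>"
  shows "block \<pi> \<alpha> i (emb c * x) = c * block \<pi> \<alpha> i x"
proof -
  have "emb c * x = (\<Sum>j<degree \<pi>. emb (c * block \<pi> \<alpha> j x) * \<alpha> ^ j)"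
    by (simp only: emb.hom_mult mult.assoc sum_distrib_left[symmetric] lincomb_block[symmetric])
  then show ?thesis using block_lincomb[OF assms] by simp
qed

section \<open>Linear functionals over the prime field and self-duality\<close>

sublocale ext: vector_space "\<lambda>c :: 'p mod_ring. \<lambda>x :: 'a. emb c * x"
  by unfold_locales (simp_all add: emb.hom_add emb.hom_mult algebra_simps)

lemma vector_space_prime_field: "vector_space ((*) :: 'p mod_ring \<Rightarrow> _)"
  by unfold_locales (simp_all add: algebra_simps)

sublocale ext_dual: vector_space_pair "\<lambda>c :: 'p mod_ring. \<lambda>x :: 'a. emb c * x" "(*) :: 'p mod_ring \<Rightarrow> _"
  by (intro vector_space_pair.intro ext.vector_space_axioms vector_space_prime_field)

abbreviation functional :: "('a \<Rightarrow> 'p mod_ring) \<Rightarrow> bool" where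
  "functional \<equiv> Vector_Spaces.linear (\<lambda>c x. emb c * x) (*)"

lemma functional_iff:
  "functional \<phi> \<longleftrightarrow> (\<forall>x y. \<phi> (x + y) = \<phi> x + \<phi> y) \<and> (\<forall>c x. \<phi> (emb c * x) = c * \<phi> x)"
  by (simp add: Vector_Spaces.linear_iff ext.vector_space_axioms vector_space_prime_field)

lemma functional_block: "i < degree \<pi> \<Longrightarrow> functional (block \<pi> \<alpha> i)"
  by (simp add: functional_iff block_add block_scale)

lemma functional_eqI:
  assumes "functional \<phi>" "functional \<psi>" and eq: "\<And>i. i < degree \<pi> \<Longrightarrow> \<phi> (\<alpha> ^ i) = \<psi> (\<alpha> ^ i)"
  shows "\<phi> = \<psi>"
proof
  interpret \<phi>: Vector_Spaces.linear "\<lambda>c x. emb c * x" "(*)" \<phi> by fact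
  interpret \<psi>: Vector_Spaces.linear "\<lambda>c x. emb c * x" "(*)" \<psi> by fact
  fix x
  have "\<phi> (\<Sum>i<degree \<pi>. emb (block \<pi> \<alpha> i x) * \<alpha> ^ i) =
        \<psi> (\<Sum>i<degree \<pi>. emb (block \<pi> \<alpha> i x) * \<alpha> ^ i)"
    by (simp add: \<phi>.sum \<psi>.sum \<phi>.scale \<psi>.scale eq)
  then show "\<phi> x = \<psi> x"
    by (simp only: lincomb_block[symmetric])
qed

lemma functional_block_mult: "i < degree \<pi> \<Longrightarrow> functional (\<lambda>x. block \<pi> \<alpha> i (a * x))"
  by (simp add: functional_iff block_add block_scale ring_distribs mult.left_commute[of a])

lemma block_power: "i < degree \<pi> \<Longrightarrow> block \<pi> \<alpha> i (\<alpha> ^ i) = 1"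
proof -
  assume i: "i < degree \<pi>"
  have "(\<Sum>j<degree \<pi>. emb (if j = i then 1 else 0 :: 'p mod_ring) * \<alpha> ^ j) =
        (\<Sum>j<degree \<pi>. if j = i then \<alpha> ^ j else 0)"
    by (intro sum.cong) auto
  also have "\<dots> = \<alpha> ^ i" using i by simp
  finally show ?thesis using block_lincomb[OF i, of "\<lambda>j. if j = i then 1 else 0"] by simp
qed

text \<open>Self-duality of the extension, with the coordinate functional playing the role of the trace.\<close>
lemma functional_representation:
  assumes \<phi>: "functional \<phi>"
  shows "\<exists>a. \<forall>x. \<phi> x = block \<pi> \<alpha> 0 (a * x)"
proof -
  let ?L = "{c :: 'p mod_ring list. length c = degree \<pi>}"
  let ?f = "\<lambda>a. map (\<lambda>i. block \<pi> \<alpha> 0 (a * \<alpha> ^ i)) [0..<degree \<pi>]"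
  \<comment> \<open>The list \<open>?f a\<close> holds the values of the functional of
    \<open>a\<close> on the power basis. There are as many value lists as field elements, so
    injectivity makes every functional occur.\<close>
  have inj: "inj ?f"
  proof (rule injI)
    fix a b assume eq: "?f a = ?f b"
    have "(\<lambda>x. block \<pi> \<alpha> 0 (a * x)) = (\<lambda>x. block \<pi> \<alpha> 0 (b * x))"
      using eq degree_pos by (intro functional_eqI functional_block_mult) (auto simp: list_eq_iff_nth_eq)
    then have same: "block \<pi> \<alpha> 0 (a * x) = block \<pi> \<alpha> 0 (b * x)" for x by meson
    show "a = b"
    proof (rule ccontr)
      assume "a \<noteq> b"
      \<comment> \<open>This makes \<open>(a - b) * x = 1\<close>, where the coordinate of index 0
        equals 1 rather than 0.\<close>
      define x where "x = inverse (a - b)"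
      have "a * x = 1 + b * x"
        using \<open>a \<noteq> b\<close> by (simp add: x_def field_simps)
      then have "block \<pi> \<alpha> 0 1 = 0"
        using same[of x] degree_pos by (simp add: block_add)
      then show False using block_power[OF degree_pos] by simp
    qed
  qed
  have "card ?L = CARD('a)"
    using bij_betw_same_card[OF bij_betw_coords] .
  moreover have "finite ?L"
    using finite_lists_length_eq[of "UNIV :: 'p mod_ring set" "degree \<pi>"] by simp
  ultimately have "range ?f = ?L"
    using inj by (intro card_subset_eq) (auto simp: card_image)
  then have "map (\<lambda>i. \<phi> (\<alpha> ^ i)) [0..<degree \<pi>] \<in> range ?f" by simp
  then obtain a where "map (\<lambda>i. \<phi> (\<alpha> ^ i)) [0..<degree \<pi>] = ?f a" by blast
  then have "\<phi> = (\<lambda>x. block \<pi> \<alpha> 0 (a * x))"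
    using degree_pos by (intro functional_eqI \<phi> functional_block_mult) (auto simp: list_eq_iff_nth_eq)
  then show ?thesis by blast
qed

text \<open>With \<open>block \<pi> \<alpha> 0\<close> as the fixed functional \<lambda>, these
  elements are the multipliers \<mu>.\<close>

definition dual :: "nat \<Rightarrow> 'a" where
  "dual i = (SOME a. \<forall>x. block \<pi> \<alpha> i x = block \<pi> \<alpha> 0 (a * x))"

lemma block_eq_dual: "i < degree \<pi> \<Longrightarrow> block \<pi> \<alpha> i x = block \<pi> \<alpha> 0 (dual i * x)"
  unfolding dual_def
  using someI_ex[OF functional_representation[OF functional_block, of i]] by blast

text \<open>Some functional takes prescribed values on an independent family, and self-duality turns
  it into multiplication by an element followed by \<open>block \<pi> \<alpha> 0\<close>.\<close>

lemma interpolation: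
  fixes v :: "nat \<Rightarrow> 'a" and t :: "nat \<Rightarrow> 'p mod_ring"
  assumes indep: "\<And>c :: nat \<Rightarrow> 'p mod_ring. (\<Sum>j<n. emb (c j) * v j) = 0 \<Longrightarrow> \<forall>j<n. c j = 0"
  shows "\<exists>a. \<forall>j<n. block \<pi> \<alpha> 0 (a * v j) = t j"
proof -
  \<comment> \<open>Functionals are extended from independent sets, whereas \<open>v\<close> is a
    family; equal members would satisfy the relation with coefficients 1 and -1.\<close>
  have inj: "inj_on v {..<n}"
  proof (rule inj_onI, rule ccontr)
    fix i j assume ij: "i \<in> {..<n}" "j \<in> {..<n}" "v i = v j" "i \<noteq> j"
    define c :: "nat \<Rightarrow> 'p mod_ring" where "c = (\<lambda>l. if l = i then 1 else if l = j then - 1 else 0)"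
    have "(\<Sum>l<n. emb (c l) * v l) = (\<Sum>l\<in>{i, j}. emb (c l) * v l)"
      using ij by (intro sum.mono_neutral_right) (auto simp: c_def)
    also have "\<dots> = 0" using ij by (simp add: c_def emb.hom_uminus)
    finally show False using indep[of c] ij by (auto simp: c_def)
  qed
  have "ext.independent (v ` {..<n})"
  proof (rule ext.independent_if_scalars_zero)
    fix f :: "'a \<Rightarrow> 'p mod_ring" and x assume "(\<Sum>x\<in>v ` {..<n}. emb (f x) * x) = 0" "x \<in> v ` {..<n}"
    then show "f x = 0"
      using indep[of "f \<circ> v"] by (auto simp: sum.reindex[OF inj])
  qed simp
  from ext_dual.linear_independent_extend[OF this, of "\<lambda>x. t (inv_into {..<n} v x)"]
  obtain \<phi> where \<phi>: "functional \<phi>" "\<forall>x\<in>v ` {..<n}. \<phi> x = t (inv_into {..<n} v x)" by blast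
  obtain a where "\<And>x. \<phi> x = block \<pi> \<alpha> 0 (a * x)" using functional_representation[OF \<phi>(1)] by blast
  then have "block \<pi> \<alpha> 0 (a * v j) = t j" if "j < n" for j
    using \<phi>(2) that inj by (metis image_eqI inv_into_f_f lessThan_iff)
  then show ?thesis by blast
qed

lemma dual_nonzero: "i < degree \<pi> \<Longrightarrow> dual i \<noteq> 0"
  using block_eq_dual[of i "\<alpha> ^ i"] block_power[of i] block_scale[OF degree_pos, of 0 0]
  by (auto simp: emb.hom_zero)

section \<open>From linear independence to security of block leakage\<close>

text \<open>This is the only condition on the places that security will use. It mentions neither
  \<open>k\<close> nor the secret, and it ranges over all patterns so that one choice of places
  serves them all.\<close>

definition dual_independent :: "nat \<Rightarrow> 'a list \<Rightarrow> bool" where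
  "dual_independent n X \<longleftrightarrow>
     (\<forall>i. (\<forall>j<n. i j < degree \<pi>) \<longrightarrow>
       (\<forall>c :: nat \<Rightarrow> 'p mod_ring.
         (\<Sum>j<n. emb (c j) * (dual (i j) * X ! j)) = 0 \<longrightarrow> (\<forall>j<n. c j = 0)))"

lemma block_leakage_secure:
  assumes k: "2 \<le> k" and len: "length X = n" and i: "\<forall>j<n. i j < degree \<pi>"
    and indep: "dual_independent n X"
  defines "f \<equiv> \<lambda>s. map (\<lambda>j. block \<pi> \<alpha> (i j) (s ! j)) [0..<n]"
  shows "map_pmf f (Share k X 0) = map_pmf f (Share k X s)"
proof -
  have "\<exists>a. \<forall>j<n. block \<pi> \<alpha> 0 (a * (dual (i j) * X ! j)) = block \<pi> \<alpha> (i j) s"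
  proof (rule interpolation)
    fix c :: "nat \<Rightarrow> 'p mod_ring"
    assume "(\<Sum>j<n. emb (c j) * (dual (i j) * X ! j)) = 0"
    then show "\<forall>j<n. c j = 0" using indep i unfolding dual_independent_def by blast
  qed
  then obtain a where "\<forall>j<n. block \<pi> \<alpha> 0 (a * (dual (i j) * X ! j)) = block \<pi> \<alpha> (i j) s" ..
  then have a: "block \<pi> \<alpha> (i j) (a * X ! j) = block \<pi> \<alpha> (i j) s" if "j < n" for j
    using that i block_eq_dual[of "i j" "a * X ! j"] by (simp add: mult.left_commute)
  show ?thesis
  proof (rule map_pmf_Share_shift[OF k])
    fix b bs
    have "block \<pi> \<alpha> (i j) (poly (Poly (0 # (b + a) # bs)) (X ! j)) =
          block \<pi> \<alpha> (i j) (poly (Poly (s # b # bs)) (X ! j))" if j: "j < n" for j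
    proof -
      let ?x = "X ! j"
      \<comment> \<open>The two sharing polynomials have \<open>?r\<close> in common at this place,
        so additivity of the block leaves only \<open>a * ?x\<close> to compare with
        \<open>s\<close>.\<close>
      let ?r = "?x * (b + ?x * poly (Poly bs) ?x)"
      have "poly (Poly (0 # (b + a) # bs)) ?x = a * ?x + ?r"
        by (simp add: algebra_simps)
      moreover have "poly (Poly (s # b # bs)) ?x = s + ?r" by simp
      ultimately show ?thesis using i a j by (simp only: block_add)
    qed
    then show "f (map (poly (Poly (0 # (b + a) # bs))) X) = f (map (poly (Poly (s # b # bs))) X)"
      by (simp add: f_def len del: Poly.simps)
  qed
qed


section \<open>Powers of \<alpha> and the set of bad places\<close>

text \<open>If \<open>\<alpha> ^ m = 1\<close> then \<open>\<pi>\<close> divides the polynomial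
  \<open>X ^ m - 1\<close>, so \<open>\<beta> ^ m = 1\<close> as well. The first \<open>m\<close>
  powers of \<beta> then exhaust the nonzero elements, which bounds \<open>m\<close> from
  below.\<close>

lemma inj_on_power: "inj_on (\<lambda>j. \<alpha> ^ j) {..<CARD('a) - 1}"
  and nonzero: "\<alpha> \<noteq> 0"
proof -
  obtain \<beta> :: 'a where \<beta>: "mult_generator \<beta>" "is_min_poly \<pi> \<beta>"
    using primitive by (auto simp: primitive_poly_def)
  have transfer_root: "poly (map_poly emb g) \<beta> = 0"
    if "poly (map_poly emb g) \<alpha> = 0" for g :: "'p mod_ring poly"
  proof -
    obtain q where "g = \<pi> * q" using dvd_of_root[OF \<open>poly (map_poly emb g) \<alpha> = 0\<close>] by blast
    then show ?thesis using \<beta>(2) by (simp add: is_min_poly_def emb_poly.hom_mult)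
  qed
  show \<alpha>0: "\<alpha> \<noteq> 0"
    \<comment> \<open>The polynomial \<open>X\<close>: if \<alpha> were zero, \<beta> would be zero
      too.\<close>
    using transfer_root[of "Polynomial.monom 1 1"] \<beta>(1)
    by (auto simp: poly_monom mult_generator_def)
  have order: "CARD('a) - 1 \<le> m" if m: "0 < m" "\<alpha> ^ m = 1" for m
  proof -
    have "poly (map_poly emb (Polynomial.monom 1 m - 1 :: 'p mod_ring poly)) \<beta> = 0"
      using m by (intro transfer_root) (simp add: emb_poly.hom_minus poly_monom)
    then have \<beta>m: "\<beta> ^ m = 1"
      by (simp add: emb_poly.hom_minus poly_monom)
    have "UNIV - {0} \<subseteq> (\<lambda>e. \<beta> ^ e) ` {..<m}"
    proof
      fix x :: 'a assume "x \<in> UNIV - {0}"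
      then obtain e where e: "x = \<beta> ^ e" using \<beta>(1) by (auto simp: mult_generator_def)
      have "\<beta> ^ e = \<beta> ^ (m * (e div m) + e mod m)" by simp
      also have "\<dots> = \<beta> ^ (e mod m)"
        by (simp only: power_add power_mult \<beta>m power_one mult_1)
      finally show "x \<in> (\<lambda>e. \<beta> ^ e) ` {..<m}" using e m by auto
    qed
    then have "card (UNIV - {0 :: 'a}) \<le> card {..<m}"
      by (rule surj_card_le[rotated]) simp
    then show ?thesis by (simp add: card_Diff_singleton)
  qed
  have less: False if "i < j" "j < CARD('a) - 1" "\<alpha> ^ i = \<alpha> ^ j" for i j
  proof -
    have "\<alpha> ^ i * \<alpha> ^ (j - i) = \<alpha> ^ i * 1"
      using that power_add[of \<alpha> i "j - i"] by simp
    then have "\<alpha> ^ (j - i) = 1" using \<alpha>0 by simp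
    then show False using order[of "j - i"] that by simp
  qed
  show "inj_on (\<lambda>j. \<alpha> ^ j) {..<CARD('a) - 1}"
    by (rule inj_onI) (metis less lessThan_iff linorder_neqE_nat)
qed

lemma exists_bad_set:
  assumes n: "0 < n" "n \<le> CARD('a) - 1" and card: "2 < CARD('a)"
  obtains Bad where "Bad \<subseteq> UNIV - {0}"
    and "card Bad \<le> n + n * (degree \<pi> * CARD('p)) ^ n"
    and "\<And>x0. x0 \<in> (UNIV - {0}) - Bad \<Longrightarrow> \<exists>X. length X = n \<and>
           (\<forall>j<n. (Phi \<alpha> ^^ j) (Fin x0) = Fin (X ! j)) \<and> distinct X \<and> 0 \<notin> set X \<and>
           dual_independent n X"
proof
  define c where "c j = (\<Sum>i<j. \<alpha> ^ i)" for j
  have c: "(\<alpha> - 1) * c j = \<alpha> ^ j - 1" for j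
    by (simp add: c_def power_diff_1_eq)
  \<comment> \<open>The exponents 0 and 1 both lie below \<open>CARD('a) - 1\<close>; this is where
    more than two field elements are needed.\<close>
  have \<alpha>1: "\<alpha> \<noteq> 1"
    using inj_onD[OF inj_on_power, of 0 1] card by (auto simp: less_diff_conv)
  have pow_inj: "i = j" if "\<alpha> ^ i = \<alpha> ^ j" "i < n" "j < n" for i j
    using that inj_onD[OF inj_on_power, of i j] n by auto
  have c_inj: "inj_on c {..<n}"
    by (rule inj_onI) (metis c pow_inj diff_add_cancel lessThan_iff)
  \<comment> \<open>\<open>D\<close> collects the possible coefficients of a relation over all block
    indices at once, so the union bound over \<open>E\<close> covers all patterns and all scalar
    tuples together.\<close>
  define D where "D = (\<lambda>(i, a :: 'p mod_ring). emb a * dual i) ` ({..<degree \<pi>} \<times> UNIV)"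
  define E where "E = {e. set e \<subseteq> D \<and> length e = n \<and> (\<exists>j<n. e ! j \<noteq> 0)}"
  define Z where "Z e = {y. (\<forall>j\<in>{..<n}. y + c j \<noteq> 0) \<and>
      (\<Sum>j<n. (e ! j * \<alpha> ^ j) / (y + c j)) = 0}" for e
  \<comment> \<open>Index 0 is left out because \<open>- c 0 = 0\<close> is the inverse of no
    nonzero place. The \<open>n - 1\<close> other poles and the fixed point of the affine map give
    the summand \<open>n\<close>.\<close>
  define Y where "Y = (\<lambda>j. - c j) ` {1..<n} \<union> {inverse (\<alpha> - 1)} \<union> (\<Union>e\<in>E. Z e)"
  \<comment> \<open>Since \<open>inverse 0 = 0\<close>, a zero in \<open>Y\<close> would contribute
    the place 0; removing it loses no nonzero place.\<close>
  define Bad where "Bad = inverse ` Y - {0}"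
  show "Bad \<subseteq> UNIV - {0}" by (auto simp: Bad_def)
  have card_D: "card D \<le> degree \<pi> * CARD('p)"
    unfolding D_def by (rule order_trans[OF card_image_le]) (auto simp: card_cartesian_product)
  have "card E \<le> card {e. set e \<subseteq> D \<and> length e = n}"
    unfolding E_def by (rule card_mono) (auto simp: finite_lists_length_eq)
  also have "\<dots> = card D ^ n" by (simp add: card_lists_length_eq)
  also have "\<dots> \<le> (degree \<pi> * CARD('p)) ^ n" by (rule power_mono[OF card_D]) simp
  finally have card_E: "card E \<le> (degree \<pi> * CARD('p)) ^ n" .
  have fin_E: "finite E"
    by (rule finite_subset[of _ "{e. set e \<subseteq> D \<and> length e = n}"])
      (auto simp: E_def finite_lists_length_eq)
  have card_Z: "card (Z e) \<le> n" if "e \<in> E" for e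
  proof -
    have "\<exists>j\<in>{..<n}. e ! j * \<alpha> ^ j \<noteq> 0" using that nonzero by (auto simp: E_def)
    from card_partial_fraction_zeros(2)[OF _ c_inj this] show ?thesis by (simp add: Z_def)
  qed
  have "card (\<Union>e\<in>E. Z e) \<le> (\<Sum>e\<in>E. card (Z e))" by (rule card_UN_le[OF fin_E])
  also have "\<dots> \<le> card E * n" using sum_bounded_above[of E "\<lambda>e. card (Z e)" n] card_Z by simp
  also have "\<dots> \<le> n * (degree \<pi> * CARD('p)) ^ n" using card_E by (simp add: mult.commute)
  finally have card_UZ: "card (\<Union>e\<in>E. Z e) \<le> n * (degree \<pi> * CARD('p)) ^ n" .
  have "card Bad \<le> card Y"
    unfolding Bad_def by (rule order_trans[OF card_Diff1_le card_image_le]) simp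
  also have "\<dots> \<le> card ((\<lambda>j. - c j) ` {1..<n}) + 1 + card (\<Union>e\<in>E. Z e)"
    unfolding Y_def by (rule order_trans[OF card_Un_le], rule add_right_mono, rule order_trans[OF card_Un_le]) simp
  also have "card ((\<lambda>j. - c j) ` {1..<n}) \<le> n - 1"
    by (rule order_trans[OF card_image_le]) auto
  finally show "card Bad \<le> n + n * (degree \<pi> * CARD('p)) ^ n"
    using card_UZ n by linarith

  fix x0 assume x0: "x0 \<in> (UNIV - {0}) - Bad"
  define y where "y = inverse x0"
  have x0_nz: "x0 \<noteq> 0" and "x0 = inverse y" using x0 by (auto simp: y_def)
  then have y: "y \<notin> Y" using x0 by (auto simp: Bad_def)
  have pole: "y + c j \<noteq> 0" if "j < n" for j
  proof (cases "j = 0")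
    case True
    then show ?thesis using x0_nz by (simp add: y_def c_def)
  next
    case False
    then have "- c j \<in> Y" using that by (auto simp: Y_def)
    then show ?thesis using y by (auto simp: add_eq_0_iff2)
  qed
  define X where "X = map (\<lambda>j. \<alpha> ^ j / (y + c j)) [0..<n]"
  have X_nth: "X ! j = \<alpha> ^ j / (y + c j)" if "j < n" for j
    using that by (simp add: X_def)
  have orbit: "(Phi \<alpha> ^^ j) (Fin x0) = Fin (X ! j)" if "j < n" for j
    using Phi_funpow[OF x0_nz, of j \<alpha>] pole that by (simp add: X_nth c_def y_def)
  have "i = j" if ij: "i < n" "j < n" "X ! i = X ! j" for i j
  proof -
    have "\<alpha> ^ i * (y + c j) = \<alpha> ^ j * (y + c i)"
      using ij pole by (simp add: X_nth field_simps)
    then have "\<alpha> ^ i * ((\<alpha> - 1) * y + (\<alpha> - 1) * c j) = \<alpha> ^ j * ((\<alpha> - 1) * y + (\<alpha> - 1) * c i)"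
      by (metis distrib_left mult.left_commute)
    \<comment> \<open>Substituting \<open>(\<alpha> - 1) * c j = \<alpha> ^ j - 1\<close> makes the
      collision factor: either the powers agree, or \<open>y\<close> is the excluded fixed
      point.\<close>
    then have "(\<alpha> ^ i - \<alpha> ^ j) * ((\<alpha> - 1) * y - 1) = 0"
      unfolding c by (simp add: algebra_simps)
    moreover have "(\<alpha> - 1) * y \<noteq> 1"
      using y inverse_unique[of "\<alpha> - 1" y] by (auto simp: Y_def)
    ultimately show "i = j" using pow_inj ij by simp
  qed
  then have "distinct X" by (auto simp: distinct_conv_nth X_def)
  moreover have "0 \<notin> set X" using pole nonzero by (auto simp: X_def)
  moreover have "\<forall>j<n. f j = 0"
    if i: "\<forall>j<n. i j < degree \<pi>" and f: "(\<Sum>j<n. emb (f j) * (dual (i j) * X ! j)) = 0"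
    for i and f :: "nat \<Rightarrow> 'p mod_ring"
  proof (rule ccontr)
    assume "\<not> (\<forall>j<n. f j = 0)"
    then obtain j where j: "j < n" "f j \<noteq> 0" by blast
    \<comment> \<open>A nontrivial relation among the \<open>dual (i j) * X ! j\<close> is an
      equation in \<open>y\<close> with these coefficients; one of them is nonzero because
      \<open>dual\<close> never vanishes on block indices.\<close>
    define e where "e = map (\<lambda>j. emb (f j) * dual (i j)) [0..<n]"
    have "e ! j \<noteq> 0" using j i dual_nonzero by (simp add: e_def)
    moreover have "set e \<subseteq> D" using i by (force simp: e_def D_def)
    ultimately have "e \<in> E" using j by (auto simp: E_def e_def)
    moreover have "y \<in> Z e"
    proof -
      have "(\<Sum>j<n. (e ! j * \<alpha> ^ j) / (y + c j)) = (\<Sum>j<n. emb (f j) * (dual (i j) * X ! j))"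
        by (intro sum.cong) (simp_all add: e_def X_nth mult.assoc)
      with f pole show ?thesis by (simp add: Z_def)
    qed
    ultimately show False using y by (auto simp: Y_def)
  qed
  then have "dual_independent n X" by (simp add: dual_independent_def)
  ultimately show "\<exists>X. length X = n \<and>
           (\<forall>j<n. (Phi \<alpha> ^^ j) (Fin x0) = Fin (X ! j)) \<and> distinct X \<and> 0 \<notin> set X \<and>
           dual_independent n X"
    using orbit by (intro exI[of _ X]) (auto simp: X_def)
qed

section \<open>Security against the three leakage families\<close>

text \<open>Bit leakage and functions of blocks are postprocessings of block leakage, and equal
  distributions have equal images.\<close>

lemma perfectly_secure_leakages:
  assumes k: "2 \<le> k" and len: "length X = n"
    and indep: "dual_independent n X"
  shows "perfectly_secure k X (block_leakages \<pi> \<alpha> n)"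
    and "perfectly_secure k X (bit_leakages \<pi> \<alpha> n)"
    and "perfectly_secure k X (block_fun_leakages \<pi> \<alpha> n S)"
proof -
  define L where "L i s = map (\<lambda>j. block \<pi> \<alpha> (i j) (s ! j)) [0..<n]" for i s
  have secure: "map_pmf (L i) (Share k X 0) = map_pmf (L i) (Share k X s)"
    if i: "\<forall>j<n. i j < degree \<pi>" for i s
    unfolding L_def by (rule block_leakage_secure[OF k len i indep])
  have post: "map_pmf g (Share k X 0) = map_pmf g (Share k X s)"
    if "\<forall>j<n. i j < degree \<pi>" and g: "g = (\<lambda>s. h (L i s))"
    for i s and g :: "'a list \<Rightarrow> 'c" and h
  proof -
    have "map_pmf g (Share k X t) = map_pmf h (map_pmf (L i) (Share k X t))" for t
      by (simp add: g pmf.map_comp comp_def)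
    then show ?thesis using secure[OF that(1)] by metis
  qed
  show "perfectly_secure k X (block_leakages \<pi> \<alpha> n)"
    using secure by (auto simp: perfectly_secure_def block_leakages_def L_def[abs_def])
  show "perfectly_secure k X (bit_leakages \<pi> \<alpha> n)"
    unfolding perfectly_secure_def
  proof (intro ballI allI impI)
    fix f s assume "f \<in> bit_leakages \<pi> \<alpha> n"
    then obtain i b where i: "\<forall>j<n. i j < degree \<pi>"
      and f: "f = (\<lambda>s. map (\<lambda>j. bit_string (block \<pi> \<alpha> (i j) (s ! j)) ! b j) [0..<n])"
      unfolding bit_leakages_def by blast
    have "f = (\<lambda>s. (\<lambda>l. map (\<lambda>j. bit_string (l ! j) ! b j) [0..<n]) (L i s))"
      by (simp add: f L_def fun_eq_iff)
    from post[OF i this] show "map_pmf f (Share k X 0) = map_pmf f (Share k X s)" .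
  qed
  show "perfectly_secure k X (block_fun_leakages \<pi> \<alpha> n S)"
    unfolding perfectly_secure_def
  proof (intro ballI allI impI)
    fix f s assume "f \<in> block_fun_leakages \<pi> \<alpha> n S"
    then obtain i g where i: "\<forall>j<n. i j < degree \<pi>"
      and f: "f = (\<lambda>s. map (\<lambda>j. g j (block \<pi> \<alpha> (i j) (s ! j))) [0..<n])"
      unfolding block_fun_leakages_def by blast
    have "f = (\<lambda>s. (\<lambda>l. map (\<lambda>j. g j (l ! j)) [0..<n]) (L i s))"
      by (simp add: f L_def fun_eq_iff)
    from post[OF i this] show "map_pmf f (Share k X 0) = map_pmf f (Share k X s)" .
  qed
qed

end

section \<open>Numerical estimates\<close>

text \<open>Exponentiating the hypothesis gives \<open>2 * M < p ^ d\<close> with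
  \<open>M = n * (d * p) ^ n\<close>. As \<open>(d * p) ^ n \<ge> 2\<close>, also
  \<open>n + 1 \<le> 2 * n \<le> M\<close>, which absorbs both the extra \<open>n\<close> and the
  excluded zero element.\<close>

lemma good_params_bound:
  assumes good: "good_params p d n" and p: "2 \<le> p" and d: "2 \<le> d" and n: "0 < n"
  shows "n + n * (d * p) ^ n < p ^ d - 1"
proof -
  have "log p (real ((d * p) ^ n * (2 * n))) = real n * (1 + log p d) + log p (2 * real n)"
    using p d n by (simp add: log_mult log_nat_power)
  then have "log p (real ((d * p) ^ n * (2 * n))) < real d"
    using good by (simp add: good_params_def)
  then have "real ((d * p) ^ n * (2 * n)) < p powr real d"
    using p d n by (subst (asm) log_less_iff) auto
  then have "(d * p) ^ n * (2 * n) < p ^ d"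
    using p by (simp add: powr_realpow flip: of_nat_power of_nat_mult)
  moreover have "1 < (d * p) ^ n"
    using p d n mult_le_mono[OF d p] by (intro one_less_power) auto
  then have "n * 2 \<le> n * (d * p) ^ n" by (intro mult_le_mono2) simp
  moreover have "(d * p) ^ n * (2 * n) = 2 * (n * (d * p) ^ n)" by simp
  ultimately show ?thesis using n by linarith
qed

text \<open>With \<open>L = log p (p * d) \<ge> 1\<close> the hypothesis reads
  \<open>n * L \<le> d / 3\<close>. From \<open>2 * n \<le> 2 ^ n \<le> p ^ n\<close> the remaining
  logarithm is at most \<open>n \<le> n * L\<close>, so the total is at most
  \<open>2 * d / 3\<close>. The argument works for any positive constant below 1/2.\<close>

lemma good_params_of_le:
  assumes adm: "admissible p d k n"
    and le: "real n \<le> 1 / 3 * real d / log p (real p * real d)"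
  shows "good_params p d n"
proof -
  have p: "2 \<le> p" and d: "2 \<le> d" and n: "2 \<le> n"
    using adm by (auto simp: admissible_def dest: prime_ge_2_nat)
  define L where "L = log p (real p * real d)"
  have L: "L = 1 + log p d" using p d by (simp add: L_def log_mult)
  have "0 \<le> log p d" using p d by simp
  then have L1: "1 \<le> L" using L by simp
  then have nL: "real n * L \<le> 1 / 3 * real d"
    using le by (simp add: L_def field_simps)
  have "2 * n \<le> 2 ^ n"
    using n by (induction n rule: dec_induct) auto
  also have "\<dots> \<le> p ^ n" using p by (intro power_mono) auto
  finally have "2 * real n \<le> real p powr real n"
    using p by (simp add: powr_realpow flip: of_nat_power)
  then have "log p (2 * real n) \<le> real n"
    using p n by (subst log_le_iff) auto
  also have "\<dots> \<le> real n * L" using L1 by (simp add: mult_le_cancel_left1)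
  finally have "real n * L + log p (2 * real n) \<le> 2 / 3 * real d" using nL by linarith
  also have "\<dots> < real d" using d by simp
  finally show ?thesis by (simp add: good_params_def L)
qed

section \<open>Perfect security for places on an orbit of \<open>Phi\<close>\<close>

theorem theorem1p1:
  fixes p d k n :: nat
    and \<pi> :: "'p::prime_card mod_ring poly"
    and \<alpha> :: "'a::{field,finite}"
  assumes p: "p = CARD('p)"
    and card_field: "CARD('a) = p ^ d"
    and params: "admissible p d k n"
    and primitive: "primitive_poly TYPE('a) \<pi>"
    and degree: "degree \<pi> = d"
    and root: "poly (map_poly emb \<pi>) \<alpha> = 0"
  shows
    "(\<exists>Bad :: 'a set.
        Bad \<subseteq> UNIV - {0} \<and>
        card Bad \<le> n + n * (d * p) ^ n \<and>
        (\<forall>x0 \<in> (UNIV - {0}) - Bad. \<exists>X :: 'a list.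
            length X = n \<and>
            (\<forall>j<n. (Phi \<alpha> ^^ j) (Fin x0) = Fin (X ! j)) \<and>
            distinct X \<and> 0 \<notin> set X \<and>
            perfectly_secure k X (block_leakages \<pi> \<alpha> n) \<and>
            perfectly_secure k X (bit_leakages \<pi> \<alpha> n) \<and>
            (\<forall>S :: nat \<Rightarrow> 's set. (\<forall>j<n. finite (S j) \<and> S j \<noteq> {}) \<longrightarrow>
                perfectly_secure k X (block_fun_leakages \<pi> \<alpha> n S))) \<and>
        (good_params p d n \<longrightarrow> (UNIV - {0}) - Bad \<noteq> {})) \<and>
     (\<exists>c::real. c > 0 \<and>
        (\<forall>p d k n. admissible p d k n \<longrightarrow>
            real n \<le> c * real d / log (real p) (real p * real d) \<longrightarrow> good_params p d n))"
proof (rule conjI)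
  interpret primitive_extension \<pi> \<alpha>
    using p card_field primitive degree root by unfold_locales simp_all
  have p2: "2 \<le> p" using p prime_card[where 'a='p] by (simp add: prime_ge_2_nat)
  have d: "2 \<le> d" and k: "2 \<le> k" and n: "0 < n" "n \<le> CARD('a) - 1"
    using params card_field by (auto simp: admissible_def degree p)
  have "2 ^ 2 \<le> p ^ d"
    using p2 d by (meson order_trans power_increasing power_mono one_le_numeral zero_le)
  then have "2 < CARD('a)" using card_field by (simp add: degree p)
  from exists_bad_set[OF n this] obtain Bad where Bad: "Bad \<subseteq> UNIV - {0}"
    "card Bad \<le> n + n * (d * p) ^ n"
    and good: "\<And>x0. x0 \<in> (UNIV - {0}) - Bad \<Longrightarrow> \<exists>X. length X = n \<and>
           (\<forall>j<n. (Phi \<alpha> ^^ j) (Fin x0) = Fin (X ! j)) \<and> distinct X \<and> 0 \<notin> set X \<and>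
           dual_independent n X"
    unfolding degree p[symmetric] by blast
  have nonempty: "(UNIV - {0}) - Bad \<noteq> {}" if "good_params p d n"
  proof
    assume "(UNIV - {0}) - Bad = {}"
    \<comment> \<open>Otherwise \<open>Bad\<close> would contain all \<open>p ^ d - 1\<close>
      nonzero elements, more than its size bound allows.\<close>
    then have "card (UNIV - {0 :: 'a}) \<le> card Bad" by (intro card_mono) auto
    then show False
      using Bad(2) good_params_bound[OF that p2 d n(1)] card_field
      by (simp add: card_Diff_singleton degree p)
  qed
  have places: "\<exists>X :: 'a list. length X = n \<and>
            (\<forall>j<n. (Phi \<alpha> ^^ j) (Fin x0) = Fin (X ! j)) \<and>
            distinct X \<and> 0 \<notin> set X \<and>
            perfectly_secure k X (block_leakages \<pi> \<alpha> n) \<and>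
            perfectly_secure k X (bit_leakages \<pi> \<alpha> n) \<and>
            (\<forall>S :: nat \<Rightarrow> 's set. (\<forall>j<n. finite (S j) \<and> S j \<noteq> {}) \<longrightarrow>
                perfectly_secure k X (block_fun_leakages \<pi> \<alpha> n S))"
    if "x0 \<in> (UNIV - {0}) - Bad" for x0
  proof -
    obtain X where X: "length X = n" "\<forall>j<n. (Phi \<alpha> ^^ j) (Fin x0) = Fin (X ! j)"
      "distinct X" "0 \<notin> set X"
      and indep: "dual_independent n X"
      using good[OF \<open>x0 \<in> (UNIV - {0}) - Bad\<close>] by blast
    then show ?thesis
      using perfectly_secure_leakages[OF k] by blast
  qed
  show "\<exists>Bad :: 'a set.
        Bad \<subseteq> UNIV - {0} \<and>
        card Bad \<le> n + n * (d * p) ^ n \<and>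
        (\<forall>x0 \<in> (UNIV - {0}) - Bad. \<exists>X :: 'a list.
            length X = n \<and>
            (\<forall>j<n. (Phi \<alpha> ^^ j) (Fin x0) = Fin (X ! j)) \<and>
            distinct X \<and> 0 \<notin> set X \<and>
            perfectly_secure k X (block_leakages \<pi> \<alpha> n) \<and>
            perfectly_secure k X (bit_leakages \<pi> \<alpha> n) \<and>
            (\<forall>S :: nat \<Rightarrow> 's set. (\<forall>j<n. finite (S j) \<and> S j \<noteq> {}) \<longrightarrow>
                perfectly_secure k X (block_fun_leakages \<pi> \<alpha> n S))) \<and>
        (good_params p d n \<longrightarrow> (UNIV - {0}) - Bad \<noteq> {})"
    using Bad places nonempty by blast
  show "\<exists>c::real. c > 0 \<and>
        (\<forall>p d k n. admissible p d k n \<longrightarrow>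
            real n \<le> c * real d / log (real p) (real p * real d) \<longrightarrow> good_params p d n)"
    using good_params_of_le by (intro exI[of _ "1 / 3"]) auto
qed

end
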